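(* Consider an infinite horizon discounted cost POMDP with state space $\{1,\dots,X\}$, actions (sensing modes) $u\in\{1,2\}$, a transition matrix $P$ common to both actions, finite observation spaces $\mathcal Y^{(u)}=\{1,\dots,Y^{(u)}\}$ with observation matrices $B(u)$ ($X\times Y^{(u)}$ stochastic matrices), costs $C(\pi,u)$ and discount factor $\rho\in[0,1)$. Assume that $C(\pi,u)$ is concave in $\pi\in\Pi(X)$ for each action $u$. Suppose $B(2)$ Blackwell dominates $B(1)$, i.e. $B(1)=B(2)R$ where $R$ is a stochastic matrix. Let $\Pi^s=\{\pi\in\Pi(X):C(\pi,2)<C(\pi,1)\}$ and define the myopic policy $\underline\mu(\pi)=2$ if $\pi\in\Pi^s$ and $\underline\mu(\pi)=1$ otherwise. Then $\underline\mu$ is a lower bound to the optimal policy $\mu^*$, i.e. $\mu^*(\pi)\ge\underline\mu(\pi)$ for all $\pi\in\Pi(X)$. In particular, for $\pi\in\Pi^s$, $\mu^*(\pi)=\underline\mu(\pi)$, i.e. it is optimal to choose action 2 when the belief is in $\Pi^s$.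
   Context: $\Pi(X)$ is the set of probability vectors in $\mathbb R^X$. $B_{iy}(u)=\mathbb P(y^{(u)}=y\mid x=i,u)$. $R$ has dimension $Y^{(2)}\times Y^{(1)}$. The objective is to minimize $J_\mu(\pi)=\mathbb E_\mu\{\sum_{k\ge0}\rho^kC(\pi_k,u_k)\}$ over stationary policies $u_k=\mu(\pi_k)$. Bellman's equation: $V(\pi)=\min_{u\in\{1,2\}}Q(\pi,u)$, $\mu^*(\pi)=\arg\min_{u\in\{1,2\}}Q(\pi,u)$, $Q(\pi,u)=C(\pi,u)+\rho\sum_{y\in\mathcal Y^{(u)}}V(T(\pi,y,u))\sigma(\pi,y,u)$, with $T(\pi,y,u)=B_y(u)P'\pi/\sigma(\pi,y,u)$, $\sigma(\pi,y,u)=\mathbf 1'B_y(u)P'\pi$, $B_y(u)=\mathrm{diag}(B_{1y}(u),\dots,B_{Xy}(u))$. *)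

theory Defs
  imports "HOL-Analysis.Analysis" "HOL-Probability.Probability"
begin

definition stochastic_matrix :: "'a set \<Rightarrow> 'b set \<Rightarrow> ('a \<Rightarrow> 'b \<Rightarrow> real) \<Rightarrow> bool" where
  "stochastic_matrix I J A \<longleftrightarrow> (\<forall>i\<in>I. (\<forall>j\<in>J. 0 \<le> A i j) \<and> (\<Sum>j\<in>J. A i j) = 1)"

text \<open>
  The states are the elements of a finite type. Actions are natural numbers, of which only
  1 and 2 are used. Under action u the observations are 1, ..., \<open>num_obs u\<close>, and
  \<open>obs u i y\<close> is the probability of observing y when the state is i. The row index of
  \<open>trans\<close> is the current state. The cost is a function of the belief and the action; only
  its values on the probability simplex matter.
\<close>

record ('x::finite) pomdp =
  trans :: "real^'x^'x"
  num_obs :: "nat \<Rightarrow> nat"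
  obs :: "nat \<Rightarrow> 'x \<Rightarrow> nat \<Rightarrow> real"
  cost :: "real^'x \<Rightarrow> nat \<Rightarrow> real"
  discount :: real

definition actions :: "nat set" where
  "actions = {1, 2}"

definition obs_space :: "('x::finite) pomdp \<Rightarrow> nat \<Rightarrow> nat set" where
  "obs_space M u = {1..num_obs M u}"

definition is_pomdp :: "('x::finite) pomdp \<Rightarrow> bool" where
  "is_pomdp M \<longleftrightarrow>
     stochastic_matrix UNIV UNIV (\<lambda>i j. trans M $ i $ j) \<and>
     (\<forall>u\<in>actions. stochastic_matrix UNIV (obs_space M u) (obs M u)) \<and>
     0 \<le> discount M \<and> discount M < 1"

definition beliefs :: "(real^'x::finite) set" where
  "beliefs = {p. (\<forall>i. 0 \<le> p $ i) \<and> (\<Sum>i\<in>UNIV. p $ i) = 1}"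

definition obs_diag :: "('x::finite) pomdp \<Rightarrow> nat \<Rightarrow> nat \<Rightarrow> real^'x^'x" where
  "obs_diag M y u = (\<chi> i j. if i = j then obs M u i y else 0)"

definition sigma :: "('x::finite) pomdp \<Rightarrow> real^'x \<Rightarrow> nat \<Rightarrow> nat \<Rightarrow> real" where
  "sigma M p y u = (\<Sum>i\<in>UNIV. (obs_diag M y u *v (transpose (trans M) *v p)) $ i)"

text \<open>
  If \<open>sigma M p y u = 0\<close> then the following is the zero vector. This is harmless, since such
  an observation has probability 0 and its term in \<open>Q_value\<close> has factor 0.
\<close>

definition belief_update :: "('x::finite) pomdp \<Rightarrow> real^'x \<Rightarrow> nat \<Rightarrow> nat \<Rightarrow> real^'x" where
  "belief_update M p y u =
     (1 / sigma M p y u) *\<^sub>R (obs_diag M y u *v (transpose (trans M) *v p))"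

definition vec_pmf :: "real^'x::finite \<Rightarrow> 'x pmf" where
  "vec_pmf p = embed_pmf (\<lambda>i. p $ i)"

definition obs_pmf :: "('x::finite) pomdp \<Rightarrow> nat \<Rightarrow> 'x \<Rightarrow> nat pmf" where
  "obs_pmf M u i = embed_pmf (\<lambda>y. if y \<in> obs_space M u then obs M u i y else 0)"

definition stationary_policies :: "(real^'x::finite \<Rightarrow> nat) set" where
  "stationary_policies = {\<mu>. \<forall>p\<in>beliefs. \<mu> p \<in> actions}"

text \<open>
  Joint distribution of the hidden state and the belief at time k under the policy \<open>\<mu>\<close>,
  when the initial state has distribution p: the action \<open>\<mu> q\<close> is chosen from the current
  belief q, the state then moves from x to x', and y is observed from x'.
\<close>

primrec process :: "('x::finite) pomdp \<Rightarrow> (real^'x \<Rightarrow> nat) \<Rightarrow> real^'x \<Rightarrow> nat \<Rightarrow> ('x \<times> (real^'x)) pmf" where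
  "process M \<mu> p 0 = map_pmf (\<lambda>x. (x, p)) (vec_pmf p)"
| "process M \<mu> p (Suc k) =
     bind_pmf (process M \<mu> p k) (\<lambda>(x, q).
       bind_pmf (vec_pmf (trans M $ x)) (\<lambda>x'.
         map_pmf (\<lambda>y. (x', belief_update M q y (\<mu> q))) (obs_pmf M (\<mu> q) x')))"

text \<open>
  The expected discounted cost, with the expectation taken termwise. Costs that are concave
  on the simplex are bounded there, so expectation and infinite sum may be interchanged.
\<close>

definition discounted_cost :: "('x::finite) pomdp \<Rightarrow> (real^'x \<Rightarrow> nat) \<Rightarrow> real^'x \<Rightarrow> real" where
  "discounted_cost M \<mu> p =
     (\<Sum>k. discount M ^ k *
            measure_pmf.expectation (process M \<mu> p k) (\<lambda>(x, q). cost M q (\<mu> q)))"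

definition value_fn :: "('x::finite) pomdp \<Rightarrow> real^'x \<Rightarrow> real" where
  "value_fn M p = (INF \<mu>\<in>stationary_policies. discounted_cost M \<mu> p)"

definition Q_value :: "('x::finite) pomdp \<Rightarrow> real^'x \<Rightarrow> nat \<Rightarrow> real" where
  "Q_value M p u =
     cost M p u +
     discount M * (\<Sum>y\<in>obs_space M u. value_fn M (belief_update M p y u) * sigma M p y u)"

text \<open>
  The minimiser of \<open>Q_value\<close> need not be unique; any selection of minimisers qualifies.
\<close>

definition optimal_policy :: "('x::finite) pomdp \<Rightarrow> (real^'x \<Rightarrow> nat) \<Rightarrow> bool" where
  "optimal_policy M \<mu> \<longleftrightarrow>
     (\<forall>p\<in>beliefs. is_arg_min (Q_value M p) (\<lambda>u. u \<in> actions) (\<mu> p))"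

definition blackwell_dominates :: "('x::finite) pomdp \<Rightarrow> nat \<Rightarrow> nat \<Rightarrow> bool" where
  "blackwell_dominates M u v \<longleftrightarrow>
     (\<exists>R. stochastic_matrix (obs_space M u) (obs_space M v) R \<and>
          (\<forall>i. \<forall>y\<in>obs_space M v. obs M v i y = (\<Sum>z\<in>obs_space M u. obs M u i z * R z y)))"

definition myopic_set :: "('x::finite) pomdp \<Rightarrow> (real^'x) set" where
  "myopic_set M = {p \<in> beliefs. cost M p 2 < cost M p 1}"

definition myopic_policy :: "('x::finite) pomdp \<Rightarrow> real^'x \<Rightarrow> nat" where
  "myopic_policy M p = (if p \<in> myopic_set M then 2 else 1)"

end

theory Submission
  imports Defs
begin

text \<open>
  The value function \<open>V\<close> is concave on the simplex: the hidden state has law \<open>q\<close> given the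
  belief \<open>q\<close>, so the cost of a stationary policy satisfies a fixed-point equation for
  beliefs alone, and \<open>V\<close> is the limit of the value iterates, whose concavity is
  preserved in each step. Extend \<open>V\<close> to the nonnegative cone with degree-one homogeneity; a
  concave \<open>V\<close> then becomes superadditive. The unnormalised updates under \<open>B(1) = B(2) R\<close> are
  nonnegative combinations of those under \<open>B(2)\<close>, so the expected value of \<open>V\<close> after
  action 2 is at most that after action 1. Hence, where action 2 is also myopically
  cheaper, it is the only minimiser of \<open>Q\<close>.
\<close>

section \<open>Homogeneous extensions of concave functions on the simplex\<close>

definition nonneg_vec :: "real^'x::finite \<Rightarrow> bool" where
  "nonneg_vec w \<longleftrightarrow> (\<forall>i. 0 \<le> w $ i)"

definition mass :: "real^'x::finite \<Rightarrow> real" where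
  "mass w = (\<Sum>i\<in>UNIV. w $ i)"

text \<open>The perspective of \<open>g\<close>: its extension from the simplex to the nonnegative
  cone, homogeneous of degree one. At \<open>w = 0\<close> the factor \<open>mass w\<close> forces
  the value 0.\<close>

definition persp :: "(real^'x::finite \<Rightarrow> real) \<Rightarrow> real^'x \<Rightarrow> real" where
  "persp g w = mass w * g ((1 / mass w) *\<^sub>R w)"

lemma mass_add: "mass (v + w) = mass v + mass w"
  by (simp add: mass_def sum.distrib)

lemma mass_scaleR: "mass (c *\<^sub>R w) = c * mass w"
  by (simp add: mass_def sum_distrib_left)

lemma mass_nonneg: "nonneg_vec w \<Longrightarrow> 0 \<le> mass w"
  by (simp add: mass_def nonneg_vec_def sum_nonneg)

lemma mass_eq_0_iff: "nonneg_vec w \<Longrightarrow> mass w = 0 \<longleftrightarrow> w = 0"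
  by (simp add: mass_def nonneg_vec_def sum_nonneg_eq_0_iff vec_eq_iff)

lemma nonneg_vec_scaleR: "nonneg_vec w \<Longrightarrow> 0 \<le> c \<Longrightarrow> nonneg_vec (c *\<^sub>R w)"
  by (simp add: nonneg_vec_def)

lemma nonneg_vec_sum: "(\<And>i. i \<in> A \<Longrightarrow> nonneg_vec (w i)) \<Longrightarrow> nonneg_vec (sum w A)"
  by (simp add: nonneg_vec_def sum_nonneg)

lemma beliefs_iff: "p \<in> beliefs \<longleftrightarrow> nonneg_vec p \<and> mass p = 1"
  by (simp add: beliefs_def nonneg_vec_def mass_def)

lemma normalize_in_beliefs:
  assumes "nonneg_vec w" "mass w > 0"
  shows "(1 / mass w) *\<^sub>R w \<in> beliefs"
  using assms by (simp add: beliefs_iff nonneg_vec_scaleR mass_scaleR)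

lemma persp_zero [simp]: "persp g 0 = 0"
  by (simp add: persp_def mass_def)

lemma persp_belief: "p \<in> beliefs \<Longrightarrow> persp g p = g p"
  by (simp add: persp_def beliefs_iff)

lemma persp_scaleR: "persp g (c *\<^sub>R w) = c * persp g w"
  by (cases "c = 0", simp, simp add: persp_def mass_scaleR)

text \<open>Normalising \<open>v + w\<close> gives a convex combination of the normalised
  \<open>v\<close> and \<open>w\<close>, weighted by their shares of the total mass; concavity,
  multiplied by \<open>s + t\<close>, is the claim. Zero vectors cannot be normalised and are
  treated apart.\<close>

lemma persp_superadditive:
  assumes "concave_on beliefs g" "nonneg_vec v" "nonneg_vec w"
  shows "persp g v + persp g w \<le> persp g (v + w)"
proof (cases "v = 0 \<or> w = 0")
  case False
  define s t where "s = mass v" and "t = mass w"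
  have pos: "s > 0" "t > 0"
    using False assms mass_nonneg[of v] mass_nonneg[of w] mass_eq_0_iff[of v] mass_eq_0_iff[of w]
    unfolding s_def t_def by linarith+
  have "(s / (s+t)) * g ((1/s) *\<^sub>R v) + (t / (s+t)) * g ((1/t) *\<^sub>R w)
        \<le> g ((s / (s+t)) *\<^sub>R ((1/s) *\<^sub>R v) + (t / (s+t)) *\<^sub>R ((1/t) *\<^sub>R w))"
    using pos normalize_in_beliefs[OF assms(2)] normalize_in_beliefs[OF assms(3)]
    by (intro assms(1)[unfolded concave_on_iff, THEN conjunct2, rule_format])
      (auto simp: s_def t_def simp flip: add_divide_distrib)
  also have "(s / (s+t)) *\<^sub>R ((1/s) *\<^sub>R v) + (t / (s+t)) *\<^sub>R ((1/t) *\<^sub>R w) = (1/(s+t)) *\<^sub>R (v + w)"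
    using pos by (simp add: scaleR_add_right)
  finally have "(s * g ((1/s) *\<^sub>R v) + t * g ((1/t) *\<^sub>R w)) / (s+t) \<le> g ((1/(s+t)) *\<^sub>R (v + w))"
    by (simp add: add_divide_distrib)
  then show ?thesis
    using pos by (simp add: persp_def mass_add pos_divide_le_eq mult.commute flip: s_def t_def)
qed auto

lemma persp_superadditive_sum:
  assumes "concave_on beliefs g" "finite A" "\<And>i. i \<in> A \<Longrightarrow> nonneg_vec (w i)"
  shows "(\<Sum>i\<in>A. persp g (w i)) \<le> persp g (\<Sum>i\<in>A. w i)"
  using assms(2,3)
proof (induction A rule: finite_induct)
  case (insert a A)
  then show ?case
    using persp_superadditive[OF assms(1), of "w a" "sum w A"] nonneg_vec_sum[of A w] by force
qed simp

lemma axis_in_beliefs: "axis i 1 \<in> beliefs"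
  by (simp add: beliefs_def axis_def)

text \<open>Jensen's inequality in homogeneous form: decompose \<open>w\<close> along the unit
  vectors and use superadditivity.\<close>

lemma persp_ge_vertices:
  assumes "concave_on beliefs g" "nonneg_vec w"
  shows "(\<Sum>i\<in>UNIV. w $ i * g (axis i 1)) \<le> persp g w"
proof -
  have "(\<Sum>i\<in>UNIV. w $ i *\<^sub>R axis i 1) = w"
    by (simp add: vec_eq_iff axis_def if_distrib cong: if_cong)
  moreover have "nonneg_vec (w $ i *\<^sub>R axis i 1)" for i
    using assms(2) by (auto simp: nonneg_vec_def axis_def)
  ultimately have "(\<Sum>i\<in>UNIV. persp g (w $ i *\<^sub>R axis i 1)) \<le> persp g w"
    using persp_superadditive_sum[OF assms(1), of UNIV "\<lambda>i. w $ i *\<^sub>R axis i 1"] by simp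
  then show ?thesis
    by (simp add: persp_scaleR persp_belief axis_in_beliefs)
qed

text \<open>A concave function may jump at the boundary of the simplex, so compactness is no help.
  The vertices give the lower bound; the upper one follows from superadditivity along
  \<open>e = p + (e - p)\<close> and the lower bound at \<open>e - p\<close>.\<close>

lemma concave_on_beliefs_bounded:
  assumes "concave_on beliefs (g :: real^'x::finite \<Rightarrow> real)"
  shows "\<exists>b. \<forall>p\<in>beliefs. \<bar>g p\<bar> \<le> b"
proof -
  define m where "m = (\<Sum>i\<in>UNIV. \<bar>g (axis i 1)\<bar>)"
  \<comment> \<open>The all-ones vector dominates every belief, so \<open>e - p\<close> stays in the
    nonnegative cone.\<close>
  define e :: "real^'x" where "e = (\<chi> i. 1)"
  \<comment> \<open>Stated for all vectors with entries between 0 and 1, to cover both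
    \<open>p\<close> and \<open>e - p\<close>.\<close>
  have low: "- m \<le> persp g w" if "nonneg_vec w" "\<And>i. w $ i \<le> 1" for w
  proof -
    have "\<bar>\<Sum>i\<in>UNIV. w $ i * g (axis i 1)\<bar> \<le> m"
      unfolding m_def using that
      by (intro order_trans[OF sum_abs] sum_mono)
        (auto simp: abs_mult nonneg_vec_def intro!: mult_left_le_one_le)
    then show ?thesis
      using persp_ge_vertices[OF assms that(1)] by linarith
  qed
  have "\<bar>g p\<bar> \<le> \<bar>persp g e\<bar> + m" if "p \<in> beliefs" for p
  proof -
    have p: "nonneg_vec p" "\<And>i. p $ i \<le> 1"
      using that member_le_sum[of _ UNIV "\<lambda>i. p $ i"] by (auto simp: beliefs_def nonneg_vec_def)
    have ep: "nonneg_vec (e - p)" "\<And>i. (e - p) $ i \<le> 1"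
      using p by (auto simp: e_def nonneg_vec_def)
    have "g p + persp g (e - p) \<le> persp g e"
      using persp_superadditive[OF assms p(1) ep(1)] that by (simp add: persp_belief)
    moreover have "- m \<le> g p"
      using low[OF p] that by (simp add: persp_belief)
    ultimately show ?thesis
      using low[OF ep] by linarith
  qed
  then show ?thesis by blast
qed


section \<open>Belief updates and Blackwell dominance\<close>

text \<open>The joint weights of the next state and the observation \<open>y\<close>; unlike the
  normalised update they are linear in \<open>p\<close>.\<close>

definition unnormalized_update :: "('x::finite) pomdp \<Rightarrow> real^'x \<Rightarrow> nat \<Rightarrow> nat \<Rightarrow> real^'x" where
  "unnormalized_update M p y u = obs_diag M y u *v (transpose (trans M) *v p)"

definition expected_next :: "('x::finite) pomdp \<Rightarrow> (real^'x \<Rightarrow> real) \<Rightarrow> real^'x \<Rightarrow> nat \<Rightarrow> real" where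
  "expected_next M g p u = (\<Sum>y\<in>obs_space M u. g (belief_update M p y u) * sigma M p y u)"

lemma sigma_eq_mass: "sigma M p y u = mass (unnormalized_update M p y u)"
  by (simp add: sigma_def mass_def unnormalized_update_def)

lemma belief_update_eq:
  "belief_update M p y u
    = (1 / mass (unnormalized_update M p y u)) *\<^sub>R unnormalized_update M p y u"
  by (simp add: belief_update_def sigma_eq_mass unnormalized_update_def)

text \<open>The probability of an observation is the mass of its unnormalised update, which is just
  the weight in \<open>persp\<close>. This leaves \<open>persp g\<close> at arguments linear in
  \<open>p\<close>.\<close>

lemma expected_next_eq_persp:
  "expected_next M g p u = (\<Sum>y\<in>obs_space M u. persp g (unnormalized_update M p y u))"
  by (simp add: expected_next_def persp_def sigma_eq_mass belief_update_eq mult.commute)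

lemma unnormalized_update_nth:
  "unnormalized_update M p y u $ i = obs M u i y * (\<Sum>j\<in>UNIV. trans M $ j $ i * p $ j)"
  by (simp add: unnormalized_update_def obs_diag_def matrix_vector_mult_def transpose_def
      if_distrib [of "\<lambda>a. a * b" for b] cong: if_cong)

lemma unnormalized_update_combination:
  "unnormalized_update M (a *\<^sub>R p + b *\<^sub>R q) y u
    = a *\<^sub>R unnormalized_update M p y u + b *\<^sub>R unnormalized_update M q y u"
  by (simp add: vec_eq_iff unnormalized_update_nth distrib_left sum.distrib sum_distrib_left mult_ac)

lemma finite_obs_space [simp]: "finite (obs_space M u)"
  by (simp add: obs_space_def)

lemma expected_next_mult_left:
  "expected_next M (\<lambda>q. c * g q) p u = c * expected_next M g p u"
  by (simp add: expected_next_def sum_distrib_left mult.assoc)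

locale valid_pomdp =
  fixes M :: "('x::finite) pomdp"
  assumes valid: "is_pomdp M"
begin

lemma discount_nonneg: "0 \<le> discount M" and discount_less_1: "discount M < 1"
  using valid by (simp_all add: is_pomdp_def)

lemma trans_row_in_beliefs: "trans M $ x \<in> beliefs"
  using valid by (simp add: is_pomdp_def stochastic_matrix_def beliefs_def)

lemma obs_nonneg: "u \<in> actions \<Longrightarrow> y \<in> obs_space M u \<Longrightarrow> 0 \<le> obs M u i y"
  using valid by (simp add: is_pomdp_def stochastic_matrix_def)

lemma sum_obs: "u \<in> actions \<Longrightarrow> (\<Sum>y\<in>obs_space M u. obs M u i y) = 1"
  using valid by (simp add: is_pomdp_def stochastic_matrix_def)

lemma nonneg_unnormalized_update:
  assumes "p \<in> beliefs" "u \<in> actions" "y \<in> obs_space M u"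
  shows "nonneg_vec (unnormalized_update M p y u)"
  using assms trans_row_in_beliefs obs_nonneg
  by (auto simp: nonneg_vec_def unnormalized_update_nth beliefs_def intro!: mult_nonneg_nonneg sum_nonneg)

lemma sigma_nonneg:
  assumes "p \<in> beliefs" "u \<in> actions" "y \<in> obs_space M u"
  shows "0 \<le> sigma M p y u"
  using nonneg_unnormalized_update[OF assms] by (simp add: sigma_eq_mass mass_nonneg)

lemma belief_update_in_beliefs:
  assumes "p \<in> beliefs" "u \<in> actions" "y \<in> obs_space M u" "sigma M p y u \<noteq> 0"
  shows "belief_update M p y u \<in> beliefs"
  using nonneg_unnormalized_update[OF assms(1-3)] sigma_nonneg[OF assms(1-3)] assms(4)
  by (simp add: sigma_eq_mass belief_update_eq normalize_in_beliefs)

text \<open>True also for \<open>sigma M p y u = 0\<close>: a nonnegative vector of mass 0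
  vanishes.\<close>

lemma sigma_mult_belief_update_nth:
  assumes "p \<in> beliefs" "u \<in> actions" "y \<in> obs_space M u"
  shows "sigma M p y u * belief_update M p y u $ x = unnormalized_update M p y u $ x"
  using mass_eq_0_iff[OF nonneg_unnormalized_update[OF assms]]
  by (auto simp: sigma_eq_mass belief_update_eq)

lemma sum_sigma:
  assumes "p \<in> beliefs" "u \<in> actions"
  shows "(\<Sum>y\<in>obs_space M u. sigma M p y u) = 1"
proof -
  have "(\<Sum>y\<in>obs_space M u. sigma M p y u)
      = (\<Sum>i\<in>UNIV. \<Sum>y\<in>obs_space M u. obs M u i y * (\<Sum>j\<in>UNIV. trans M $ j $ i * p $ j))"
    unfolding sigma_eq_mass mass_def unnormalized_update_nth by (rule sum.swap)
  also have "\<dots> = (\<Sum>i\<in>UNIV. \<Sum>j\<in>UNIV. trans M $ j $ i * p $ j)"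
    by (simp add: sum_obs assms flip: sum_distrib_right)
  also have "\<dots> = (\<Sum>j\<in>UNIV. \<Sum>i\<in>UNIV. trans M $ j $ i * p $ j)"
    by (rule sum.swap)
  also have "\<dots> = 1"
    using trans_row_in_beliefs assms by (simp add: beliefs_def flip: sum_distrib_right)
  finally show ?thesis .
qed

text \<open>Comparing \<open>g\<close> and \<open>h\<close> on beliefs suffices: an observation of
  probability 0 has the zero vector as update, which is no belief, but its term vanishes.\<close>

lemma expected_next_mono:
  assumes "p \<in> beliefs" "u \<in> actions" "\<And>q. q \<in> beliefs \<Longrightarrow> g q \<le> h q"
  shows "expected_next M g p u \<le> expected_next M h p u"
  unfolding expected_next_def
proof (rule sum_mono)
  fix y assume "y \<in> obs_space M u"
  then show "g (belief_update M p y u) * sigma M p y u \<le> h (belief_update M p y u) * sigma M p y u"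
    using assms sigma_nonneg belief_update_in_beliefs
    by (cases "sigma M p y u = 0") (auto intro!: mult_right_mono)
qed

lemma expected_next_cong:
  assumes "p \<in> beliefs" "u \<in> actions" "\<And>q. q \<in> beliefs \<Longrightarrow> g q = h q"
  shows "expected_next M g p u = expected_next M h p u"
  using expected_next_mono[OF assms(1,2), of g h] expected_next_mono[OF assms(1,2), of h g] assms(3)
  by force

lemma expected_next_add_const:
  assumes "p \<in> beliefs" "u \<in> actions"
  shows "expected_next M (\<lambda>q. g q + c) p u = expected_next M g p u + c"
  using sum_sigma[OF assms]
  by (simp add: expected_next_def distrib_right sum.distrib flip: sum_distrib_left)

lemma expected_next_le_add_const:
  assumes "p \<in> beliefs" "u \<in> actions" "\<And>q. q \<in> beliefs \<Longrightarrow> g q \<le> h q + c"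
  shows "expected_next M g p u \<le> expected_next M h p u + c"
  using expected_next_mono[OF assms] by (simp add: expected_next_add_const assms)

lemma abs_expected_next_le:
  assumes "p \<in> beliefs" "u \<in> actions" "\<And>q. q \<in> beliefs \<Longrightarrow> \<bar>g q\<bar> \<le> c"
  shows "\<bar>expected_next M g p u\<bar> \<le> c"
proof -
  have "g q \<le> 0 + c" "0 \<le> g q + c" if "q \<in> beliefs" for q
    using assms(3)[OF that] by linarith+
  moreover have "expected_next M (\<lambda>_. 0) p u = 0"
    by (simp add: expected_next_def)
  ultimately show ?thesis
    using expected_next_le_add_const[of p u g "\<lambda>_. 0" c] expected_next_le_add_const[of p u "\<lambda>_. 0" g c]
      assms by force
qed

text \<open>Each summand is \<open>persp g\<close> after a linear map, and a superadditive,
  homogeneous function is concave.\<close>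

lemma expected_next_concave:
  assumes "concave_on beliefs g" "u \<in> actions"
  shows "concave_on beliefs (\<lambda>p. expected_next M g p u)"
  unfolding concave_on_iff
proof (intro conjI ballI allI impI)
  show "convex (beliefs :: (real^'x) set)"
    using assms(1) by (rule concave_on_imp_convex)
next
  fix p q :: "real^'x" and a b :: real
  assume pq: "p \<in> beliefs" "q \<in> beliefs" and ab: "0 \<le> a" "0 \<le> b" "a + b = 1"
  show "a * expected_next M g p u + b * expected_next M g q u
      \<le> expected_next M g (a *\<^sub>R p + b *\<^sub>R q) u"
    unfolding expected_next_eq_persp sum_distrib_left unnormalized_update_combination
      persp_scaleR[symmetric] sum.distrib[symmetric]
    using pq ab assms
    by (intro sum_mono persp_superadditive nonneg_vec_scaleR nonneg_unnormalized_update)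
qed

text \<open>Since the rows of \<open>R\<close> sum to 1, each term for \<open>z\<close> splits over
  \<open>y\<close> with weights \<open>R z y\<close>. Homogeneity moves the weights inside, and
  superadditivity merges the terms over \<open>z\<close> into the update for the garbled observation
  \<open>y\<close>.\<close>

lemma blackwell_expected_next_le:
  assumes "concave_on beliefs g" "blackwell_dominates M u v" "u \<in> actions" "p \<in> beliefs"
  shows "expected_next M g p u \<le> expected_next M g p v"
proof -
  obtain R where R: "stochastic_matrix (obs_space M u) (obs_space M v) R"
    and obs_eq: "\<And>i y. y \<in> obs_space M v \<Longrightarrow> obs M v i y = (\<Sum>z\<in>obs_space M u. obs M u i z * R z y)"
    using assms(2) unfolding blackwell_dominates_def by blast
  have garble: "unnormalized_update M p y v
      = (\<Sum>z\<in>obs_space M u. R z y *\<^sub>R unnormalized_update M p z u)"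
    if "y \<in> obs_space M v" for y
  proof -
    define s where "s i = (\<Sum>j\<in>UNIV. trans M $ j $ i * p $ j)" for i
    show ?thesis
      using that
      by (simp add: vec_eq_iff unnormalized_update_nth obs_eq sum_distrib_left mult_ac flip: s_def)
  qed
  have "expected_next M g p u
      = (\<Sum>z\<in>obs_space M u. \<Sum>y\<in>obs_space M v. R z y * persp g (unnormalized_update M p z u))"
    using R by (simp add: expected_next_eq_persp stochastic_matrix_def flip: sum_distrib_right)
  also have "\<dots> = (\<Sum>y\<in>obs_space M v. \<Sum>z\<in>obs_space M u. persp g (R z y *\<^sub>R unnormalized_update M p z u))"
    unfolding persp_scaleR by (rule sum.swap)
  also have "\<dots> \<le> (\<Sum>y\<in>obs_space M v. persp g (unnormalized_update M p y v))"
  proof (rule sum_mono)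
    fix y assume y: "y \<in> obs_space M v"
    show "(\<Sum>z\<in>obs_space M u. persp g (R z y *\<^sub>R unnormalized_update M p z u))
        \<le> persp g (unnormalized_update M p y v)"
      unfolding garble[OF y] using R y assms
      by (intro persp_superadditive_sum nonneg_vec_scaleR nonneg_unnormalized_update)
        (auto simp: stochastic_matrix_def)
  qed
  finally show ?thesis
    by (simp add: expected_next_eq_persp)
qed

end


section \<open>The belief process\<close>

lemma pmf_vec_pmf:
  assumes "p \<in> beliefs"
  shows "pmf (vec_pmf p) x = p $ x"
  unfolding vec_pmf_def using assms
  by (intro pmf_embed_pmf) (auto simp: beliefs_def nn_integral_count_space_finite sum_ennreal)

lemma (in valid_pomdp) pmf_obs_pmf:
  assumes "u \<in> actions"
  shows "pmf (obs_pmf M u x) y = (if y \<in> obs_space M u then obs M u x y else 0)"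
  unfolding obs_pmf_def
proof (rule pmf_embed_pmf)
  show "0 \<le> (if y \<in> obs_space M u then obs M u x y else 0)" for y
    using obs_nonneg assms by simp
  have "(\<integral>\<^sup>+ y. ennreal (if y \<in> obs_space M u then obs M u x y else 0) \<partial>count_space UNIV)
      = (\<Sum>y\<in>obs_space M u. ennreal (if y \<in> obs_space M u then obs M u x y else 0))"
    by (rule nn_integral_count_space') auto
  then show "(\<integral>\<^sup>+ y. ennreal (if y \<in> obs_space M u then obs M u x y else 0) \<partial>count_space UNIV) = 1"
    using assms by (simp add: sum_ennreal obs_nonneg sum_obs)
qed

text \<open>The transition operator of the belief chain under \<open>\<mu>\<close>.\<close>

definition policy_next :: "('x::finite) pomdp \<Rightarrow> (real^'x \<Rightarrow> nat) \<Rightarrow> (real^'x \<Rightarrow> real) \<Rightarrow> real^'x \<Rightarrow> real" where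
  "policy_next M \<mu> g q = expected_next M g q (\<mu> q)"

text \<open>The conditional expectation of \<open>F\<close> given the belief \<open>q\<close>, when
  the hidden state has law \<open>q\<close>.\<close>

definition belief_mean :: "('x::finite \<times> (real^'x) \<Rightarrow> real) \<Rightarrow> real^'x \<Rightarrow> real" where
  "belief_mean F q = (\<Sum>x\<in>UNIV. q $ x * F (x, q))"

definition process_step :: "('x::finite) pomdp \<Rightarrow> (real^'x \<Rightarrow> nat) \<Rightarrow> ('x \<times> (real^'x)) \<Rightarrow> ('x \<times> (real^'x)) pmf" where
  "process_step M \<mu> = (\<lambda>(x, q).
     bind_pmf (vec_pmf (trans M $ x)) (\<lambda>x'.
       map_pmf (\<lambda>y. (x', belief_update M q y (\<mu> q))) (obs_pmf M (\<mu> q) x')))"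

lemma process_Suc: "process M \<mu> p (Suc k) = bind_pmf (process M \<mu> p k) (process_step M \<mu>)"
  by (simp add: process_step_def)

lemma stationary_policies_in_actions:
  "\<mu> \<in> stationary_policies \<Longrightarrow> p \<in> beliefs \<Longrightarrow> \<mu> p \<in> actions"
  by (simp add: stationary_policies_def)

context valid_pomdp
begin

lemma set_obs_pmf:
  "u \<in> actions \<Longrightarrow> set_pmf (obs_pmf M u x) = {y \<in> obs_space M u. obs M u x y \<noteq> 0}"
  by (auto simp: set_pmf_eq pmf_obs_pmf)

lemma set_vec_pmf: "p \<in> beliefs \<Longrightarrow> set_pmf (vec_pmf p) = {x. p $ x \<noteq> 0}"
  by (auto simp: set_pmf_eq pmf_vec_pmf)

text \<open>The invariant that the belief gives the true state positive weight excludes observations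
  of probability 0, so only genuine beliefs are reached. Finite support turns expectations into
  finite sums.\<close>

lemma set_process_step:
  assumes "\<mu> q \<in> actions" "q \<in> beliefs" "q $ x \<noteq> 0"
  shows "finite (set_pmf (process_step M \<mu> (x, q)))"
    and "set_pmf (process_step M \<mu> (x, q)) \<subseteq> {(x', q'). q' \<in> beliefs \<and> q' $ x' \<noteq> 0}"
proof -
  show "finite (set_pmf (process_step M \<mu> (x, q)))"
    using assms by (simp add: process_step_def set_obs_pmf)
  show "set_pmf (process_step M \<mu> (x, q)) \<subseteq> {(x', q'). q' \<in> beliefs \<and> q' $ x' \<noteq> 0}"
  proof clarify
    fix x' q' assume "(x', q') \<in> set_pmf (process_step M \<mu> (x, q))"
    then obtain y where y: "y \<in> obs_space M (\<mu> q)" "obs M (\<mu> q) x' y \<noteq> 0"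
      and x': "trans M $ x $ x' \<noteq> 0" and q': "q' = belief_update M q y (\<mu> q)"
      using assms by (auto simp: process_step_def set_obs_pmf set_vec_pmf trans_row_in_beliefs)
    \<comment> \<open>The summand for \<open>j = x\<close> is positive and the others are
      nonnegative.\<close>
    have "(\<Sum>j\<in>UNIV. trans M $ j $ x' * q $ j) \<noteq> 0"
      using x' assms trans_row_in_beliefs by (subst sum_nonneg_eq_0_iff) (auto simp: beliefs_def)
    then have "unnormalized_update M q y (\<mu> q) $ x' \<noteq> 0"
      using y by (simp add: unnormalized_update_nth)
    \<comment> \<open>A nonzero product yields both claims: the observation has positive
      probability, and \<open>q'\<close> charges \<open>x'\<close>.\<close>
    then have "sigma M q y (\<mu> q) * q' $ x' \<noteq> 0"
      using sigma_mult_belief_update_nth assms y q' by simp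
    then show "q' \<in> beliefs \<and> q' $ x' \<noteq> 0"
      using belief_update_in_beliefs assms y q' by simp
  qed
qed

lemma set_process:
  assumes "\<mu> \<in> stationary_policies" "p \<in> beliefs"
  shows "finite (set_pmf (process M \<mu> p k)) \<and>
    set_pmf (process M \<mu> p k) \<subseteq> {(x, q). q \<in> beliefs \<and> q $ x \<noteq> 0}"
proof (induction k)
  case 0
  then show ?case using assms by (auto simp: set_vec_pmf)
next
  case (Suc k)
  have "finite (set_pmf (process_step M \<mu> z)) \<and>
      set_pmf (process_step M \<mu> z) \<subseteq> {(x', q'). q' \<in> beliefs \<and> q' $ x' \<noteq> 0}"
    if "z \<in> set_pmf (process M \<mu> p k)" for z
  proof -
    obtain x q where z: "z = (x, q)" by (cases z)
    then have q: "q \<in> beliefs" "q $ x \<noteq> 0"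
      using Suc that by auto
    show ?thesis
      unfolding z using q assms(1) by (intro conjI set_process_step stationary_policies_in_actions)
  qed
  then show ?case
    using Suc unfolding process_Suc set_bind_pmf by blast
qed

lemma expectation_process_step:
  assumes "\<mu> q \<in> actions"
  shows "measure_pmf.expectation (process_step M \<mu> (x, q)) F
    = (\<Sum>x'\<in>UNIV. trans M $ x $ x' *
        (\<Sum>y\<in>obs_space M (\<mu> q). obs M (\<mu> q) x' y * F (x', belief_update M q y (\<mu> q))))"
proof -
  have "measure_pmf.expectation (obs_pmf M (\<mu> q) x') f
      = (\<Sum>y\<in>obs_space M (\<mu> q). obs M (\<mu> q) x' y * f y)" for x' and f :: "nat \<Rightarrow> real"
    using assms
    by (subst integral_measure_pmf_real[of "obs_space M (\<mu> q)"])
      (auto simp: set_obs_pmf pmf_obs_pmf mult.commute)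
  then show ?thesis
    unfolding process_step_def split using assms
    by (subst pmf_expectation_bind[of UNIV])
      (auto simp: set_obs_pmf pmf_vec_pmf trans_row_in_beliefs)
qed

text \<open>
  Bayes' rule: if the state has law \<open>q\<close> given the belief \<open>q\<close>, then this persists for one step.
\<close>

lemma belief_mean_process_step:
  assumes "\<mu> q \<in> actions" "q \<in> beliefs"
  shows "belief_mean (\<lambda>z. measure_pmf.expectation (process_step M \<mu> z) F) q
    = policy_next M \<mu> (belief_mean F) q"
proof -
  define T where "T y = belief_update M q y (\<mu> q)" for y
  define B where "B = obs M (\<mu> q)"
  define Y where "Y = obs_space M (\<mu> q)"
  \<comment> \<open>Weighting by \<open>sigma\<close> undoes the normalisation; then only finite
    sums are rearranged.\<close>
  have "policy_next M \<mu> (belief_mean F) q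
      = (\<Sum>y\<in>Y. \<Sum>x'\<in>UNIV. unnormalized_update M q y (\<mu> q) $ x' * F (x', T y))"
    unfolding policy_next_def expected_next_def belief_mean_def sum_distrib_right T_def Y_def
    using assms by (intro sum.cong refl) (simp add: mult_ac flip: sigma_mult_belief_update_nth)
  also have "\<dots> = (\<Sum>y\<in>Y. \<Sum>x'\<in>UNIV. \<Sum>x\<in>UNIV. q $ x * (trans M $ x $ x' * (B x' y * F (x', T y))))"
    by (simp add: unnormalized_update_nth B_def sum_distrib_left sum_distrib_right mult_ac)
  also have "\<dots> = (\<Sum>x'\<in>UNIV. \<Sum>y\<in>Y. \<Sum>x\<in>UNIV. q $ x * (trans M $ x $ x' * (B x' y * F (x', T y))))"
    by (rule sum.swap)
  also have "\<dots> = (\<Sum>x'\<in>UNIV. \<Sum>x\<in>UNIV. \<Sum>y\<in>Y. q $ x * (trans M $ x $ x' * (B x' y * F (x', T y))))"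
    by (intro sum.cong refl sum.swap)
  also have "\<dots> = (\<Sum>x\<in>UNIV. \<Sum>x'\<in>UNIV. \<Sum>y\<in>Y. q $ x * (trans M $ x $ x' * (B x' y * F (x', T y))))"
    by (rule sum.swap)
  finally show ?thesis
    by (simp add: belief_mean_def expectation_process_step assms sum_distrib_left T_def B_def Y_def)
qed

lemma funpow_policy_next_cong:
  assumes "\<mu> \<in> stationary_policies" "p \<in> beliefs" "\<And>q. q \<in> beliefs \<Longrightarrow> g q = h q"
  shows "(policy_next M \<mu> ^^ k) g p = (policy_next M \<mu> ^^ k) h p"
  using assms(2)
proof (induction k arbitrary: p)
  case (Suc k)
  then show ?case
    using assms(1)
    by (auto simp: policy_next_def stationary_policies_in_actions intro!: expected_next_cong)
qed (simp add: assms(3))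

lemma abs_funpow_policy_next_le:
  assumes "\<mu> \<in> stationary_policies" "p \<in> beliefs" "\<And>q. q \<in> beliefs \<Longrightarrow> \<bar>g q\<bar> \<le> c"
  shows "\<bar>(policy_next M \<mu> ^^ k) g p\<bar> \<le> c"
  using assms(2)
proof (induction k arbitrary: p)
  case (Suc k)
  then show ?case
    using assms(1)
    by (auto simp: policy_next_def stationary_policies_in_actions intro!: abs_expected_next_le)
qed (simp add: assms(3))

text \<open>Removes the hidden state. The induction peels off the last step of the process,
  replacing \<open>F\<close> by its one-step expectation, so \<open>F\<close> must be
  arbitrary.\<close>

lemma expectation_process:
  assumes "\<mu> \<in> stationary_policies" "p \<in> beliefs"
  shows "measure_pmf.expectation (process M \<mu> p k) F = (policy_next M \<mu> ^^ k) (belief_mean F) p"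
proof (induction k arbitrary: F)
  case 0
  have "measure_pmf.expectation (vec_pmf p) (\<lambda>x. F (x, p)) = belief_mean F p"
    using assms
    by (subst integral_measure_pmf_real[of UNIV])
      (auto simp: belief_mean_def pmf_vec_pmf mult.commute)
  then show ?case by simp
next
  case (Suc k)
  have set: "finite (set_pmf (process M \<mu> p k))"
      "\<And>x q. (x, q) \<in> set_pmf (process M \<mu> p k) \<Longrightarrow> q \<in> beliefs \<and> q $ x \<noteq> 0"
    using set_process[OF assms, of k] by auto
  have "measure_pmf.expectation (process M \<mu> p (Suc k)) F
      = (\<Sum>z\<in>set_pmf (process M \<mu> p k).
          pmf (process M \<mu> p k) z *\<^sub>R measure_pmf.expectation (process_step M \<mu> z) F)"
    unfolding process_Suc using set
    by (intro pmf_expectation_bind)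
      (auto intro!: set_process_step stationary_policies_in_actions[OF assms(1)])
  also have "\<dots> = measure_pmf.expectation (process M \<mu> p k)
      (\<lambda>z. measure_pmf.expectation (process_step M \<mu> z) F)"
    using set by (intro integral_measure_pmf [symmetric]) auto
  also have "\<dots> = (policy_next M \<mu> ^^ k)
      (belief_mean (\<lambda>z. measure_pmf.expectation (process_step M \<mu> z) F)) p"
    by (rule Suc)
  also have "\<dots> = (policy_next M \<mu> ^^ k) (policy_next M \<mu> (belief_mean F)) p"
    using assms
    by (intro funpow_policy_next_cong)
      (auto intro: belief_mean_process_step stationary_policies_in_actions)
  also have "\<dots> = (policy_next M \<mu> ^^ Suc k) (belief_mean F) p"
    by (simp add: funpow_Suc_right del: funpow.simps)
  finally show ?case .
qed

text \<open>The cost depends on the belief alone, so averaging over the hidden state leaves it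
  unchanged.\<close>

lemma discounted_cost_eq:
  assumes "\<mu> \<in> stationary_policies" "p \<in> beliefs"
  shows "discounted_cost M \<mu> p
    = (\<Sum>k. discount M ^ k * (policy_next M \<mu> ^^ k) (\<lambda>q. cost M q (\<mu> q)) p)"
proof -
  have "belief_mean (\<lambda>(x, q). cost M q (\<mu> q)) q = cost M q (\<mu> q)" if "q \<in> beliefs" for q
    using that by (simp add: belief_mean_def beliefs_def flip: sum_distrib_right)
  then show ?thesis
    unfolding discounted_cost_def expectation_process[OF assms]
    by (subst funpow_policy_next_cong[OF assms]) auto
qed

lemma sums_expected_next:
  assumes "p \<in> beliefs" "u \<in> actions" "\<And>q. q \<in> beliefs \<Longrightarrow> (\<lambda>k. f k q) sums g q"
  shows "(\<lambda>k. expected_next M (f k) p u) sums expected_next M g p u"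
  unfolding expected_next_def
proof (rule sums_sum)
  fix y assume "y \<in> obs_space M u"
  then show "(\<lambda>k. f k (belief_update M p y u) * sigma M p y u)
      sums (g (belief_update M p y u) * sigma M p y u)"
    using assms belief_update_in_beliefs by (cases "sigma M p y u = 0") (auto intro!: sums_mult2)
qed

end


section \<open>Value iteration\<close>

text \<open>The right-hand side of Bellman's equation for action \<open>u\<close>, with continuation
  value \<open>g\<close>.\<close>

definition backup :: "('x::finite) pomdp \<Rightarrow> (real^'x \<Rightarrow> real) \<Rightarrow> real^'x \<Rightarrow> nat \<Rightarrow> real" where
  "backup M g p u = cost M p u + discount M * expected_next M g p u"

lemma Q_value_eq_backup: "Q_value M p u = backup M (value_fn M) p u"
  by (simp add: Q_value_def backup_def expected_next_def)

primrec value_iter :: "('x::finite) pomdp \<Rightarrow> nat \<Rightarrow> real^'x \<Rightarrow> real" where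
  "value_iter M 0 = (\<lambda>_. 0)"
| "value_iter M (Suc n) = (\<lambda>p. min (backup M (value_iter M n) p 1) (backup M (value_iter M n) p 2))"

text \<open>Monotonicity and discounting combined: the one-sided form of the contraction
  property.\<close>

lemma (in valid_pomdp) backup_le_add:
  assumes "p \<in> beliefs" "u \<in> actions" "\<And>q. q \<in> beliefs \<Longrightarrow> g q \<le> h q + c"
  shows "backup M g p u \<le> backup M h p u + discount M * c"
  using mult_left_mono[OF expected_next_le_add_const[OF assms] discount_nonneg]
  by (simp add: backup_def distrib_left)

lemma concave_on_min:
  assumes "concave_on S f" "concave_on S g"
  shows "concave_on S (\<lambda>x. min (f x) (g x))"
  unfolding concave_on_iff
proof (intro conjI ballI allI impI)
  fix x y and a b :: real
  assume xy: "x \<in> S" "y \<in> S" and ab: "0 \<le> a" "0 \<le> b" "a + b = 1"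
  have "a * min (f x) (g x) + b * min (f y) (g y) \<le> a * f x + b * f y"
    "a * min (f x) (g x) + b * min (f y) (g y) \<le> a * g x + b * g y"
    using ab by (auto intro!: add_mono mult_left_mono)
  moreover have "a * f x + b * f y \<le> f (a *\<^sub>R x + b *\<^sub>R y)"
    "a * g x + b * g y \<le> g (a *\<^sub>R x + b *\<^sub>R y)"
    using assms xy ab by (auto simp: concave_on_iff)
  ultimately show "a * min (f x) (g x) + b * min (f y) (g y)
      \<le> min (f (a *\<^sub>R x + b *\<^sub>R y)) (g (a *\<^sub>R x + b *\<^sub>R y))"
    by linarith
qed (use assms in \<open>simp add: concave_on_iff\<close>)

lemma concave_on_LIMSEQ:
  assumes "\<And>n. concave_on S (f n)" "\<And>x. x \<in> S \<Longrightarrow> (\<lambda>n. f n x) \<longlonglongrightarrow> g x"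
  shows "concave_on S g"
  unfolding concave_on_iff
proof (intro conjI ballI allI impI)
  show conv: "convex S"
    using assms(1) concave_on_imp_convex by blast
  fix x y and a b :: real
  assume xy: "x \<in> S" "y \<in> S" and ab: "0 \<le> a" "0 \<le> b" "a + b = 1"
  have "a *\<^sub>R x + b *\<^sub>R y \<in> S"
    using conv xy ab by (simp add: convex_def)
  then show "a * g x + b * g y \<le> g (a *\<^sub>R x + b *\<^sub>R y)"
    using assms xy ab
    by (intro LIMSEQ_le[of "\<lambda>n. a * f n x + b * f n y" _ "\<lambda>n. f n (a *\<^sub>R x + b *\<^sub>R y)"]
        tendsto_add tendsto_mult_left) (auto simp: concave_on_iff)
qed

lemma (in valid_pomdp) value_iter_concave:
  assumes "\<And>u. u \<in> actions \<Longrightarrow> concave_on beliefs (\<lambda>p. cost M p u)"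
  shows "concave_on beliefs (value_iter M n)"
proof (induction n)
  case 0
  have "convex (beliefs :: (real^'x) set)"
    using assms[of 1] by (auto simp: actions_def dest: concave_on_imp_convex)
  then show ?case by (simp add: concave_on_const)
next
  case (Suc n)
  have "concave_on beliefs (\<lambda>p. backup M (value_iter M n) p u)" if "u \<in> actions" for u
    unfolding backup_def using that Suc
    by (intro concave_on_add concave_on_cmul assms expected_next_concave discount_nonneg)
  then show ?case by (simp add: concave_on_min actions_def)
qed

section \<open>Convergence of value iteration for bounded costs\<close>

locale bounded_cost_pomdp = valid_pomdp M for M :: "('x::finite) pomdp" +
  fixes b :: real
  assumes abs_cost_le: "u \<in> actions \<Longrightarrow> p \<in> beliefs \<Longrightarrow> \<bar>cost M p u\<bar> \<le> b"
begin

definition total_bound :: real where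
  "total_bound = b / (1 - discount M)"

text \<open>Makes the bound \<open>total_bound\<close> stable under backups.\<close>

lemma total_bound_eq: "b + discount M * total_bound = total_bound"
  using discount_less_1 by (simp add: total_bound_def field_simps)

lemma discount_power_bound_sums: "(\<lambda>k. discount M ^ k * b) sums total_bound"
  using sums_mult2[OF geometric_sums[of "discount M"], of b] discount_nonneg discount_less_1
  by (simp add: total_bound_def)

lemma discounted_term_bound:
  assumes "\<mu> \<in> stationary_policies" "p \<in> beliefs"
  shows "norm (discount M ^ k * (policy_next M \<mu> ^^ k) (\<lambda>q. cost M q (\<mu> q)) p) \<le> discount M ^ k * b"
  using assms discount_nonneg
  by (auto simp: abs_mult stationary_policies_in_actions abs_cost_le
      intro!: mult_left_mono abs_funpow_policy_next_le)

lemma discounted_cost_sums: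
  assumes "\<mu> \<in> stationary_policies" "p \<in> beliefs"
  shows "(\<lambda>k. discount M ^ k * (policy_next M \<mu> ^^ k) (\<lambda>q. cost M q (\<mu> q)) p)
    sums discounted_cost M \<mu> p"
  unfolding discounted_cost_eq[OF assms] using discounted_term_bound[OF assms]
  by (intro summable_sums summable_comparison_test'[OF sums_summable[OF discount_power_bound_sums]])

lemma abs_discounted_cost_le:
  assumes "\<mu> \<in> stationary_policies" "p \<in> beliefs"
  shows "\<bar>discounted_cost M \<mu> p\<bar> \<le> total_bound"
  using norm_sums_le[OF discounted_cost_sums[OF assms] discount_power_bound_sums]
    discounted_term_bound[OF assms] by simp

text \<open>The policy evaluation equation: split off the cost at time 0 and take one transition out
  of the remaining series.\<close>

lemma discounted_cost_backup:
  assumes "\<mu> \<in> stationary_policies" "p \<in> beliefs"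
  shows "discounted_cost M \<mu> p = backup M (discounted_cost M \<mu>) p (\<mu> p)"
proof -
  define f where "f k = (policy_next M \<mu> ^^ k) (\<lambda>q. cost M q (\<mu> q))" for k
  have f: "(\<lambda>k. discount M ^ k * f k q) sums discounted_cost M \<mu> q" if "q \<in> beliefs" for q
    unfolding f_def using assms(1) that by (rule discounted_cost_sums)
  have "(\<lambda>k. expected_next M (\<lambda>q. discount M ^ k * f k q) p (\<mu> p))
      sums expected_next M (discounted_cost M \<mu>) p (\<mu> p)"
    using assms f by (intro sums_expected_next stationary_policies_in_actions)
  \<comment> \<open>One further application of the transition operator shifts \<open>f k\<close> to
    \<open>f (Suc k)\<close>.\<close>
  then have "(\<lambda>k. discount M * (discount M ^ k * f (Suc k) p))
      sums (discount M * expected_next M (discounted_cost M \<mu>) p (\<mu> p))"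
    by (intro sums_mult) (simp add: expected_next_mult_left f_def policy_next_def)
  then have "(\<lambda>k. discount M ^ Suc k * f (Suc k) p)
      sums (discount M * expected_next M (discounted_cost M \<mu>) p (\<mu> p))"
    by (simp add: mult.assoc)
  then have "(\<lambda>k. discount M ^ k * f k p)
      sums (discount M * expected_next M (discounted_cost M \<mu>) p (\<mu> p) + discount M ^ 0 * f 0 p)"
    by (rule sums_Suc)
  then show ?thesis
    using sums_unique2[OF f[OF assms(2)]] by (simp add: backup_def f_def)
qed

lemma abs_backup_le:
  assumes "p \<in> beliefs" "u \<in> actions" "\<And>q. q \<in> beliefs \<Longrightarrow> \<bar>g q\<bar> \<le> c"
  shows "\<bar>backup M g p u\<bar> \<le> b + discount M * c"
proof -
  have "\<bar>discount M * expected_next M g p u\<bar> \<le> discount M * c"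
    using abs_expected_next_le[OF assms] discount_nonneg by (simp add: abs_mult mult_left_mono)
  then show ?thesis
    using abs_cost_le[OF assms(2,1)] by (simp add: backup_def)
qed

text \<open>The cost at any vertex of the simplex shows \<open>0 \<le> b\<close>.\<close>

lemma total_bound_nonneg: "0 \<le> total_bound"
  using abs_cost_le[of 1 "axis undefined 1"] axis_in_beliefs discount_less_1
  by (force simp: total_bound_def actions_def)

lemma abs_value_iter_le: "p \<in> beliefs \<Longrightarrow> \<bar>value_iter M n p\<bar> \<le> total_bound"
proof (induction n arbitrary: p)
  case (Suc n)
  have "\<bar>backup M (value_iter M n) p u\<bar> \<le> total_bound" if "u \<in> actions" for u
    using abs_backup_le[OF Suc.prems that Suc.IH] total_bound_eq by simp
  then show ?case by (simp add: actions_def min_def)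
qed (simp add: total_bound_nonneg)

text \<open>The minimum is at most the backup along \<open>\<mu>\<close>, and the cost of
  \<open>\<mu>\<close> is a fixed point of that backup; the initial gap \<open>total_bound\<close>
  shrinks by the discount in each step.\<close>

lemma value_iter_le_discounted_cost:
  assumes "\<mu> \<in> stationary_policies" "p \<in> beliefs"
  shows "value_iter M n p \<le> discounted_cost M \<mu> p + discount M ^ n * total_bound"
  using assms(2)
proof (induction n arbitrary: p)
  case 0
  then show ?case using abs_discounted_cost_le[OF assms(1) 0] by simp
next
  case (Suc n)
  have u: "\<mu> p \<in> actions"
    using assms(1) Suc.prems by (rule stationary_policies_in_actions)
  then have "value_iter M (Suc n) p \<le> backup M (value_iter M n) p (\<mu> p)"
    by (auto simp: actions_def)
  also have "\<dots> \<le> backup M (discounted_cost M \<mu>) p (\<mu> p) + discount M * (discount M ^ n * total_bound)"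
    using backup_le_add Suc u by blast
  finally show ?case
    using discounted_cost_backup[OF assms(1) Suc.prems] by simp
qed

lemma value_iter_Suc_le:
  "p \<in> beliefs \<Longrightarrow> value_iter M (Suc n) p \<le> value_iter M n p + discount M ^ n * b"
proof (induction n arbitrary: p)
  case 0
  have "\<bar>backup M (value_iter M 0) p 1\<bar> \<le> b + discount M * 0"
    using 0 by (intro abs_backup_le) (auto simp: actions_def)
  then show ?case by simp
next
  case (Suc n)
  have "backup M (value_iter M (Suc n)) p u \<le> backup M (value_iter M n) p u + discount M ^ Suc n * b"
    if "u \<in> actions" for u
    using backup_le_add[OF Suc.prems that Suc.IH] by (simp add: mult.assoc)
  from this[of 1] this[of 2]
  have "min (backup M (value_iter M (Suc n)) p 1) (backup M (value_iter M (Suc n)) p 2)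
      \<le> min (backup M (value_iter M n) p 1) (backup M (value_iter M n) p 2) + discount M ^ Suc n * b"
    unfolding actions_def by (auto simp del: value_iter.simps)
  then show ?case by (simp only: value_iter.simps)
qed

text \<open>Repeats forever the first decision of an optimal plan with \<open>Suc n\<close>
  stages.\<close>

definition greedy_policy :: "nat \<Rightarrow> real^'x \<Rightarrow> nat" where
  "greedy_policy n p = (if backup M (value_iter M n) p 1 \<le> backup M (value_iter M n) p 2 then 1 else 2)"

lemma greedy_policy_stationary: "greedy_policy n \<in> stationary_policies"
  by (simp add: stationary_policies_def greedy_policy_def actions_def)

lemma backup_greedy_policy: "backup M (value_iter M n) p (greedy_policy n p) = value_iter M (Suc n) p"
  by (simp add: greedy_policy_def)

lemma discounted_cost_greedy_policy_le:
  assumes "p \<in> beliefs"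
  shows "discounted_cost M (greedy_policy n) p \<le> value_iter M n p + discount M ^ n * total_bound"
proof -
  define J where "J = discounted_cost M (greedy_policy n)"
  \<comment> \<open>The worst excess of the greedy cost over the iterate. One backup gives
    \<open>D \<le> discount M ^ n * b + discount M * D\<close>, which is solved for
    \<open>D\<close>.\<close>
  define D where "D = (SUP q\<in>beliefs. J q - value_iter M n q)"
  \<comment> \<open>Without this bound the real supremum would carry no information.\<close>
  have bdd: "bdd_above ((\<lambda>q. J q - value_iter M n q) ` beliefs)"
  proof (rule bdd_aboveI2)
    show "J q - value_iter M n q \<le> 2 * total_bound" if "q \<in> beliefs" for q
      using abs_discounted_cost_le[OF greedy_policy_stationary that, of n] abs_value_iter_le[OF that, of n]
      by (simp add: J_def abs_le_iff)
  qed
  have D: "J q \<le> value_iter M n q + D" if "q \<in> beliefs" for q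
    using cSUP_upper[OF that bdd] by (simp add: D_def)
  have "D \<le> discount M ^ n * b + discount M * D"
    unfolding D_def
  proof (rule cSUP_least, fold D_def)
    show "beliefs \<noteq> ({} :: (real^'x) set)"
      using axis_in_beliefs by blast
    fix q :: "real^'x" assume q: "q \<in> beliefs"
    have "J q = backup M J q (greedy_policy n q)"
      unfolding J_def by (rule discounted_cost_backup[OF greedy_policy_stationary q])
    also have "\<dots> \<le> backup M (value_iter M n) q (greedy_policy n q) + discount M * D"
      using q D by (intro backup_le_add stationary_policies_in_actions[OF greedy_policy_stationary])
    also have "\<dots> \<le> value_iter M n q + discount M ^ n * b + discount M * D"
      unfolding backup_greedy_policy using value_iter_Suc_le[OF q, of n] by simp
    finally show "J q - value_iter M n q \<le> discount M ^ n * b + discount M * D"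
      by simp
  qed
  then have "D \<le> discount M ^ n * total_bound"
    using discount_less_1 by (simp add: total_bound_def pos_le_divide_eq algebra_simps)
  then show ?thesis
    using D[OF assms] by (simp add: J_def)
qed

text \<open>A squeeze: every policy costs at least the iterate up to a vanishing error, and the
  greedy policy at most that. Thus the infimum over policies is reached without solving Bellman's
  equation.\<close>

lemma value_iter_tendsto_value_fn:
  assumes "p \<in> beliefs"
  shows "(\<lambda>n. value_iter M n p) \<longlonglongrightarrow> value_fn M p"
proof -
  have lower: "value_iter M n p - discount M ^ n * total_bound \<le> value_fn M p" for n
    unfolding value_fn_def using greedy_policy_stationary
    by (intro cINF_greatest) (auto simp: value_iter_le_discounted_cost[OF _ assms] diff_le_eq)
  have upper: "value_fn M p \<le> value_iter M n p + discount M ^ n * total_bound" for n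
  proof -
    \<comment> \<open>A lower bound common to all policies is what puts the infimum below each
      policy's cost.\<close>
    have "- total_bound \<le> discounted_cost M \<mu> p" if "\<mu> \<in> stationary_policies" for \<mu>
      using abs_discounted_cost_le[OF that assms] by simp
    then have "value_fn M p \<le> discounted_cost M (greedy_policy n) p"
      unfolding value_fn_def by (intro cINF_lower greedy_policy_stationary bdd_belowI2)
    then show ?thesis
      using discounted_cost_greedy_policy_le[OF assms, of n] by simp
  qed
  have "(\<lambda>n. discount M ^ n * total_bound) \<longlonglongrightarrow> 0"
    using discount_nonneg discount_less_1 by (auto intro!: tendsto_mult_left_zero LIMSEQ_power_zero)
  moreover have "\<forall>\<^sub>F n in sequentially.
      norm (value_iter M n p - value_fn M p) \<le> discount M ^ n * total_bound"
    using lower upper by (auto simp: abs_le_iff diff_le_eq add.commute)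
  ultimately have "(\<lambda>n. value_iter M n p - value_fn M p) \<longlonglongrightarrow> 0"
    by (rule Lim_null_comparison [rotated])
  then show ?thesis by (simp add: LIM_zero_iff)
qed

end

section \<open>Concavity of the value function and comparison of the two actions\<close>

lemma (in valid_pomdp) value_fn_concave:
  assumes "\<And>u. u \<in> actions \<Longrightarrow> concave_on beliefs (\<lambda>p. cost M p u)"
  shows "concave_on beliefs (value_fn M)"
proof -
  \<comment> \<open>Concave costs are bounded; the larger of the two bounds serves both
    actions.\<close>
  obtain c where c: "\<And>u p. u \<in> actions \<Longrightarrow> p \<in> beliefs \<Longrightarrow> \<bar>cost M p u\<bar> \<le> c u"
    using concave_on_beliefs_bounded[OF assms] by metis
  interpret bounded_cost_pomdp M "max (c 1) (c 2)"
    by unfold_locales (use c in \<open>fastforce simp: actions_def le_max_iff_disj\<close>)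
  show ?thesis
    by (rule concave_on_LIMSEQ[OF value_iter_concave[OF assms] value_iter_tendsto_value_fn])
qed

theorem theorem8p6p1:
  fixes M :: "('x::finite) pomdp" and \<mu>_opt :: "real^'x \<Rightarrow> nat"
  assumes "is_pomdp M"
    and "\<And>u. u \<in> actions \<Longrightarrow> concave_on beliefs (\<lambda>p. cost M p u)"
    and "blackwell_dominates M 2 1"
    and "optimal_policy M \<mu>_opt"
  shows "(\<forall>p\<in>beliefs. \<mu>_opt p \<ge> myopic_policy M p) \<and>
         (\<forall>p\<in>myopic_set M. \<mu>_opt p = myopic_policy M p \<and> \<mu>_opt p = 2)"
proof -
  interpret valid_pomdp M
    by unfold_locales (rule assms(1))
  have opt: "\<mu>_opt p \<in> actions" "\<And>u. u \<in> actions \<Longrightarrow> \<not> Q_value M p u < Q_value M p (\<mu>_opt p)"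
    if "p \<in> beliefs" for p
    using assms(4) that by (auto simp: optimal_policy_def is_arg_min_def)
  have myopic: "\<mu>_opt p = 2" if "p \<in> myopic_set M" for p
  proof -
    have p: "p \<in> beliefs" "cost M p 2 < cost M p 1"
      using that by (simp_all add: myopic_set_def)
    have "expected_next M (value_fn M) p 2 \<le> expected_next M (value_fn M) p 1"
      using value_fn_concave[OF assms(2)] assms(3) p(1)
      by (intro blackwell_expected_next_le) (simp_all add: actions_def)
    \<comment> \<open>Strictness comes from the immediate cost alone; it rules out ties, so action 1
      is no minimiser.\<close>
    then have "Q_value M p 2 < Q_value M p 1"
      unfolding Q_value_eq_backup backup_def
      using p(2) discount_nonneg by (intro add_less_le_mono mult_left_mono)
    then show ?thesis
      using opt[OF p(1)] by (auto simp: actions_def)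
  qed
  \<comment> \<open>Off the myopic set the myopic action is 1, the least action.\<close>
  then show ?thesis
    using opt(1) by (fastforce simp: myopic_policy_def actions_def)
qed

end
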